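(* There is a one-sided black-box Monte Carlo algorithm for testing whether a black-box Heyting algebra is a Boolean algebra.
   Context: A Heyting algebra is a bounded distributive lattice $\langle H,\wedge,\vee,\rightarrow,\bot,\top\rangle$ in which $a\rightarrow b$ is the maximum of $\{c : a\wedge c\le b\}$; $\neg x$ abbreviates $x\rightarrow\bot$; a Boolean algebra is a Heyting algebra with $x\rightarrow y=\neg x\vee y$ for all $x,y$. A black-box Heyting algebra consists of a finite underlying Heyting algebra $H$, a set $X$ of cryptoelements (bitstrings of a fixed finite length $\ell(X)$), a decryption function $\pi:X\to H$, and fixed algorithms: (BB1) a randomized algorithm with no input producing a cryptoelement such that applying $\pi$ to its outputs gives uniformly distributed elements of $H$; (BB2) algorithms $\hat\vee,\hat\wedge,\hat\rightarrow$ taking two cryptoelements $x,y$ and producing a cryptoelement with $\pi(x\hat\vee y)=\pi(x)\vee\pi(y)$ etc.; (BB2') an algorithm producing a cryptoelement $\hat\bot$ with $\pi(\hat\bot)=\bot$ (and similarly $\hat\top$); (BB3) an algorithm taking two cryptoelements $x,y$ and outputting $1$ iff $\pi(x)=\pi(y)$, and $0$ otherwise; for uniformly given families, these algorithms run in time polynomial in $\ell(X)$. For a first-order sentence $\varphi$ in the language of Heyting algebras, a one-sided black-box Monte Carlo algorithm for testing $\varphi$ is a randomized algorithm $A$ taking as input $\langle X,\hat\vee,\dots\rangle$ of a black-box Heyting algebra $\langle H,X,\pi,\hat\vee,\dots\rangle$ such that: if $H\models\varphi$ then $A$ returns $1$; if $H\not\models\varphi$ then with probability larger than $1/2$ $A$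 returns $0$ (and $1$ otherwise); all in time polynomial in $\ell(X)$. *)

theory Defs
  imports "HOL-Probability.Probability_Mass_Function" "HOL-Computational_Algebra.Polynomial"
begin

section \<open>Heyting algebras\<close>

record 'a heyting =
  carrier :: "'a set"
  meet :: "'a \<Rightarrow> 'a \<Rightarrow> 'a"
  join :: "'a \<Rightarrow> 'a \<Rightarrow> 'a"
  imp :: "'a \<Rightarrow> 'a \<Rightarrow> 'a"
  bottom :: 'a
  topel :: 'a

definition le :: "'a heyting \<Rightarrow> 'a \<Rightarrow> 'a \<Rightarrow> bool" where
  "le H a b \<longleftrightarrow> meet H a b = a"

definition neg :: "'a heyting \<Rightarrow> 'a \<Rightarrow> 'a" where
  "neg H a = imp H a (bottom H)"

locale heyting_algebra =
  fixes H :: "'a heyting"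
  assumes bottom_closed: "bottom H \<in> carrier H"
    and top_closed: "topel H \<in> carrier H"
    and meet_closed: "\<lbrakk>a \<in> carrier H; b \<in> carrier H\<rbrakk> \<Longrightarrow> meet H a b \<in> carrier H"
    and join_closed: "\<lbrakk>a \<in> carrier H; b \<in> carrier H\<rbrakk> \<Longrightarrow> join H a b \<in> carrier H"
    and imp_closed: "\<lbrakk>a \<in> carrier H; b \<in> carrier H\<rbrakk> \<Longrightarrow> imp H a b \<in> carrier H"
    and meet_assoc: "\<lbrakk>a \<in> carrier H; b \<in> carrier H; c \<in> carrier H\<rbrakk>
          \<Longrightarrow> meet H (meet H a b) c = meet H a (meet H b c)"
    and join_assoc: "\<lbrakk>a \<in> carrier H; b \<in> carrier H; c \<in> carrier H\<rbrakk>
          \<Longrightarrow> join H (join H a b) c = join H a (join H b c)"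
    and meet_comm: "\<lbrakk>a \<in> carrier H; b \<in> carrier H\<rbrakk> \<Longrightarrow> meet H a b = meet H b a"
    and join_comm: "\<lbrakk>a \<in> carrier H; b \<in> carrier H\<rbrakk> \<Longrightarrow> join H a b = join H b a"
    and meet_absorb: "\<lbrakk>a \<in> carrier H; b \<in> carrier H\<rbrakk> \<Longrightarrow> meet H a (join H a b) = a"
    and join_absorb: "\<lbrakk>a \<in> carrier H; b \<in> carrier H\<rbrakk> \<Longrightarrow> join H a (meet H a b) = a"
    and distrib: "\<lbrakk>a \<in> carrier H; b \<in> carrier H; c \<in> carrier H\<rbrakk>
          \<Longrightarrow> meet H a (join H b c) = join H (meet H a b) (meet H a c)"
    and bottom_least: "a \<in> carrier H \<Longrightarrow> le H (bottom H) a"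
    and top_greatest: "a \<in> carrier H \<Longrightarrow> le H a (topel H)"
    and imp_mem: "\<lbrakk>a \<in> carrier H; b \<in> carrier H\<rbrakk> \<Longrightarrow> le H (meet H a (imp H a b)) b"
    and imp_greatest: "\<lbrakk>a \<in> carrier H; b \<in> carrier H; c \<in> carrier H; le H (meet H a c) b\<rbrakk>
          \<Longrightarrow> le H c (imp H a b)"

definition boolean_algebra :: "'a heyting \<Rightarrow> bool" where
  "boolean_algebra H \<longleftrightarrow> heyting_algebra H \<and>
     (\<forall>x\<in>carrier H. \<forall>y\<in>carrier H. imp H x y = join H (neg H x) y)"


section \<open>First-order sentences in the language of Heyting algebras\<close>

datatype tm = Var nat | TBot | TTop | TMeet tm tm | TJoin tm tm | TImp tm tm

datatype fm =
    FEq tm tm | FNot fm | FAnd fm fm | FOr fm fm | FImp fm fm | FAll nat fm | FEx nat fm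

primrec tm_val :: "'a heyting \<Rightarrow> (nat \<Rightarrow> 'a) \<Rightarrow> tm \<Rightarrow> 'a" where
  "tm_val H e (Var n) = e n"
| "tm_val H e TBot = bottom H"
| "tm_val H e TTop = topel H"
| "tm_val H e (TMeet s t) = meet H (tm_val H e s) (tm_val H e t)"
| "tm_val H e (TJoin s t) = join H (tm_val H e s) (tm_val H e t)"
| "tm_val H e (TImp s t) = imp H (tm_val H e s) (tm_val H e t)"

primrec sat :: "'a heyting \<Rightarrow> (nat \<Rightarrow> 'a) \<Rightarrow> fm \<Rightarrow> bool" where
  "sat H e (FEq s t) \<longleftrightarrow> tm_val H e s = tm_val H e t"
| "sat H e (FNot p) \<longleftrightarrow> \<not> sat H e p"
| "sat H e (FAnd p q) \<longleftrightarrow> sat H e p \<and> sat H e q"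
| "sat H e (FOr p q) \<longleftrightarrow> sat H e p \<or> sat H e q"
| "sat H e (FImp p q) \<longleftrightarrow> (sat H e p \<longrightarrow> sat H e q)"
| "sat H e (FAll n p) \<longleftrightarrow> (\<forall>a\<in>carrier H. sat H (e(n := a)) p)"
| "sat H e (FEx n p) \<longleftrightarrow> (\<exists>a\<in>carrier H. sat H (e(n := a)) p)"

text \<open>A formula with free variables is read as its universal closure.\<close>

definition models :: "'a heyting \<Rightarrow> fm \<Rightarrow> bool" where
  "models H p \<longleftrightarrow> (\<forall>e. range e \<subseteq> carrier H \<longrightarrow> sat H e p)"

definition boolean_sentence :: fm where
  "boolean_sentence =
     FAll 0 (FAll 1 (FEq (TImp (Var 0) (Var 1)) (TJoin (TImp (Var 0) TBot) (Var 1))))"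

lemma models_boolean_sentence:
  assumes "heyting_algebra H"
  shows "models H boolean_sentence \<longleftrightarrow> boolean_algebra H"
proof -
  have "range (\<lambda>_::nat. bottom H) \<subseteq> carrier H"
    using assms by (auto simp: heyting_algebra.bottom_closed)
  then show ?thesis
    using assms by (auto simp: models_def boolean_sentence_def boolean_algebra_def neg_def)
qed


section \<open>Black-box Heyting algebras\<close>

type_synonym bits = "bool list"

text \<open>
  The part of a black box that is visible from outside. An algorithm enters only through its
  output and its running time (the \<^typ>\<open>nat\<close> component). For the randomized sampler both are
  random, with the given joint distribution; this distribution is arbitrary, since fair coins and
  bounded time alone would only give dyadic probabilities and thus could not sample uniformly
  from, say, a three-element algebra.
\<close>

record interface =
  len :: nat
  crypto :: "bits set"
  sample_alg :: "(bits \<times> nat) pmf"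
  meet_alg :: "bits \<Rightarrow> bits \<Rightarrow> bits \<times> nat"
  join_alg :: "bits \<Rightarrow> bits \<Rightarrow> bits \<times> nat"
  imp_alg :: "bits \<Rightarrow> bits \<Rightarrow> bits \<times> nat"
  bottom_alg :: "bits \<times> nat"
  top_alg :: "bits \<times> nat"
  eq_alg :: "bits \<Rightarrow> bits \<Rightarrow> bool \<times> nat"

locale black_box = heyting_algebra H
  for H :: "'a heyting" and \<pi> :: "bits \<Rightarrow> 'a" and I :: interface +
  assumes finite_carrier: "finite (carrier H)"
    and crypto_length: "x \<in> crypto I \<Longrightarrow> length x = len I"
    and decrypt_mem: "x \<in> crypto I \<Longrightarrow> \<pi> x \<in> carrier H"
    and sample_crypto: "(x, t) \<in> set_pmf (sample_alg I) \<Longrightarrow> x \<in> crypto I"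
    and sample_uniform: "map_pmf (\<lambda>(x, t). \<pi> x) (sample_alg I) = pmf_of_set (carrier H)"
    and meet_crypto: "\<lbrakk>x \<in> crypto I; y \<in> crypto I\<rbrakk> \<Longrightarrow> fst (meet_alg I x y) \<in> crypto I"
    and join_crypto: "\<lbrakk>x \<in> crypto I; y \<in> crypto I\<rbrakk> \<Longrightarrow> fst (join_alg I x y) \<in> crypto I"
    and imp_crypto: "\<lbrakk>x \<in> crypto I; y \<in> crypto I\<rbrakk> \<Longrightarrow> fst (imp_alg I x y) \<in> crypto I"
    and bottom_crypto: "fst (bottom_alg I) \<in> crypto I"
    and top_crypto: "fst (top_alg I) \<in> crypto I"
    and decrypt_meet: "\<lbrakk>x \<in> crypto I; y \<in> crypto I\<rbrakk>
          \<Longrightarrow> \<pi> (fst (meet_alg I x y)) = meet H (\<pi> x) (\<pi> y)"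
    and decrypt_join: "\<lbrakk>x \<in> crypto I; y \<in> crypto I\<rbrakk>
          \<Longrightarrow> \<pi> (fst (join_alg I x y)) = join H (\<pi> x) (\<pi> y)"
    and decrypt_imp: "\<lbrakk>x \<in> crypto I; y \<in> crypto I\<rbrakk>
          \<Longrightarrow> \<pi> (fst (imp_alg I x y)) = imp H (\<pi> x) (\<pi> y)"
    and decrypt_bottom: "\<pi> (fst (bottom_alg I)) = bottom H"
    and decrypt_top: "\<pi> (fst (top_alg I)) = topel H"
    and eq_correct: "\<lbrakk>x \<in> crypto I; y \<in> crypto I\<rbrakk>
          \<Longrightarrow> fst (eq_alg I x y) \<longleftrightarrow> \<pi> x = \<pi> y"

definition interface_time_le :: "interface \<Rightarrow> nat \<Rightarrow> bool" where
  "interface_time_le I T \<longleftrightarrow>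
     (\<forall>(x, t) \<in> set_pmf (sample_alg I). t \<le> T) \<and>
     snd (bottom_alg I) \<le> T \<and> snd (top_alg I) \<le> T \<and>
     (\<forall>x\<in>crypto I. \<forall>y\<in>crypto I.
        snd (meet_alg I x y) \<le> T \<and> snd (join_alg I x y) \<le> T \<and>
        snd (imp_alg I x y) \<le> T \<and> snd (eq_alg I x y) \<le> T)"


section \<open>Randomized algorithms with black-box access\<close>

text \<open>
  Programs act on registers holding bitstrings, used as stacks. Besides the stack operations and
  fair coin flips they can only query the algorithms of the interface, passing the contents of
  registers as arguments.
\<close>

type_synonym reg = nat
type_synonym state = "reg \<Rightarrow> bits"

datatype query =
    QSample | QBottom | QTop | QMeet reg reg | QJoin reg reg | QImp reg reg | QEq reg reg

datatype test = IsEmpty reg | IsOne reg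

datatype com =
    Push reg bool
  | Pop reg
  | Flip reg
  | Query reg query
  | Seq com com
  | Cond test com com
  | While test com

primrec answer :: "interface \<Rightarrow> state \<Rightarrow> query \<Rightarrow> (bits \<times> nat) pmf" where
  "answer I s QSample = sample_alg I"
| "answer I s QBottom = return_pmf (bottom_alg I)"
| "answer I s QTop = return_pmf (top_alg I)"
| "answer I s (QMeet x y) = return_pmf (meet_alg I (s x) (s y))"
| "answer I s (QJoin x y) = return_pmf (join_alg I (s x) (s y))"
| "answer I s (QImp x y) = return_pmf (imp_alg I (s x) (s y))"
| "answer I s (QEq x y) = return_pmf (case eq_alg I (s x) (s y) of (b, t) \<Rightarrow> ([b], t))"

primrec holds :: "state \<Rightarrow> test \<Rightarrow> bool" where
  "holds s (IsEmpty r) \<longleftrightarrow> s r = []"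
| "holds s (IsOne r) \<longleftrightarrow> s r \<noteq> [] \<and> hd (s r)"

text \<open>
  A configuration consists of the stack of commands still to be executed, the registers, and the
  time elapsed so far. A query costs one unit plus the running time of the queried algorithm;
  every other step costs one unit.
\<close>

type_synonym config = "com list \<times> state \<times> nat"

fun step :: "interface \<Rightarrow> config \<Rightarrow> config pmf" where
  "step I ([], s, t) = return_pmf ([], s, t)"
| "step I (Push r b # K, s, t) = return_pmf (K, s(r := b # s r), t + 1)"
| "step I (Pop r # K, s, t) = return_pmf (K, s(r := tl (s r)), t + 1)"
| "step I (Flip r # K, s, t) =
     map_pmf (\<lambda>b. (K, s(r := b # s r), t + 1)) (bernoulli_pmf (1/2))"
| "step I (Query r q # K, s, t) =
     map_pmf (\<lambda>(a, u). (K, s(r := a), t + 1 + u)) (answer I s q)"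
| "step I (Seq c d # K, s, t) = return_pmf (c # d # K, s, t + 1)"
| "step I (Cond b c d # K, s, t) = return_pmf ((if holds s b then c else d) # K, s, t + 1)"
| "step I (While b c # K, s, t) =
     return_pmf (if holds s b then c # While b c # K else K, s, t + 1)"

primrec run :: "interface \<Rightarrow> nat \<Rightarrow> config \<Rightarrow> config pmf" where
  "run I 0 cf = return_pmf cf"
| "run I (Suc n) cf = bind_pmf (step I cf) (run I n)"

text \<open>The input is the length of the cryptoelements, written in unary in register 0.\<close>

definition init :: "interface \<Rightarrow> com \<Rightarrow> config" where
  "init I A = ([A], (\<lambda>_. [])(0 := replicate (len I) True), 0)"

text \<open>
  The distribution of the output (register 0 after halting) for the time limit \<open>T\<close>; \<^const>\<open>None\<close>
  stands for exceeding the limit. As each step costs at least one unit, \<open>T\<close> steps suffice.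
\<close>

definition output_within :: "interface \<Rightarrow> com \<Rightarrow> nat \<Rightarrow> bits option pmf" where
  "output_within I A T =
     map_pmf (\<lambda>(K, s, t). if K = [] \<and> t \<le> T then Some (s 0) else None) (run I T (init I A))"

text \<open>
  The polynomial \<open>p\<close> is the common time bound of the algorithms of a uniformly given family of
  black boxes, \<open>q\<close> the resulting time bound for \<open>A\<close> on this family; \<open>A\<close> itself depends on neither.
  The answers 1 and 0 are the bitstrings \<open>[True]\<close> and \<open>[False]\<close>.
\<close>

definition one_sided_monte_carlo :: "'a itself \<Rightarrow> fm \<Rightarrow> com \<Rightarrow> bool" where
  "one_sided_monte_carlo _ \<phi> A \<longleftrightarrow>
     (\<forall>p :: nat poly. \<exists>q :: nat poly. \<forall>(H :: 'a heyting) \<pi> I.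
        black_box H \<pi> I \<and> interface_time_le I (poly p (len I)) \<longrightarrow>
        (let D = output_within I A (poly q (len I)) in
           (models H \<phi> \<longrightarrow> D = return_pmf (Some [True])) \<and>
           (\<not> models H \<phi> \<longrightarrow>
              pmf D (Some [False]) > 1/2 \<and> set_pmf D \<subseteq> {Some [False], Some [True]})))"

text \<open>
  The underlying algebras are subsets of a type, and \<^typ>\<open>nat\<close> already represents all finite
  algebras: an algorithm that is correct for \<^typ>\<open>nat\<close> is correct for every type.
\<close>

definition copy :: "('a \<Rightarrow> 'b) \<Rightarrow> ('b \<Rightarrow> 'a) \<Rightarrow> 'a heyting \<Rightarrow> 'b heyting" where
  "copy f g H = \<lparr>carrier = f ` carrier H,
     meet = (\<lambda>a b. f (meet H (g a) (g b))),
     join = (\<lambda>a b. f (join H (g a) (g b))),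
     imp = (\<lambda>a b. f (imp H (g a) (g b))),
     bottom = f (bottom H), topel = f (topel H)\<rparr>"

lemma copy_heyting_algebra:
  assumes "heyting_algebra H" and gf: "\<forall>x\<in>carrier H. g (f x) = x"
  shows "heyting_algebra (copy f g H)"
proof -
  interpret heyting_algebra H by fact
  note closed = bottom_closed top_closed meet_closed join_closed imp_closed
  have inj: "f x = f y \<longleftrightarrow> x = y" if "x \<in> carrier H" "y \<in> carrier H" for x y
    using gf that by metis
  show ?thesis
    by (unfold_locales; (simp only: copy_def le_def heyting.simps);
        (elim imageE)?; hypsubst?; simp add: gf closed inj)
      (use meet_assoc join_assoc meet_comm join_comm meet_absorb join_absorb distrib
        bottom_least top_greatest imp_mem imp_greatest
       in \<open>simp_all add: le_def meet_absorb join_absorb\<close>)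
qed

lemma copy_sat:
  assumes "heyting_algebra H" and gf: "\<forall>x\<in>carrier H. g (f x) = x"
    and "range e \<subseteq> carrier H"
  shows "sat (copy f g H) (\<lambda>n. f (e n)) \<phi> \<longleftrightarrow> sat H e \<phi>"
  using assms(3)
proof (induction \<phi> arbitrary: e)
  case (FEq s t)
  interpret heyting_algebra H by fact
  have *: "tm_val H e u \<in> carrier H \<and> tm_val (copy f g H) (\<lambda>n. f (e n)) u = f (tm_val H e u)" for u
    using FEq by (induction u)
      (auto simp: copy_def gf bottom_closed top_closed meet_closed join_closed imp_closed)
  then show ?case using gf by (metis sat.simps(1))
next
  case (FAll n p)
  have "sat (copy f g H) ((\<lambda>n. f (e n))(n := f a)) p \<longleftrightarrow> sat H (e(n := a)) p"
    if "a \<in> carrier H" for a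
  proof -
    have "(\<lambda>n. f (e n))(n := f a) = (\<lambda>m. f ((e(n := a)) m))" by auto
    moreover have "range (e(n := a)) \<subseteq> carrier H" using FAll.prems that by auto
    ultimately show ?thesis using FAll.IH by metis
  qed
  then show ?case by (simp add: copy_def)
next
  case (FEx n p)
  have "sat (copy f g H) ((\<lambda>n. f (e n))(n := f a)) p \<longleftrightarrow> sat H (e(n := a)) p"
    if "a \<in> carrier H" for a
  proof -
    have "(\<lambda>n. f (e n))(n := f a) = (\<lambda>m. f ((e(n := a)) m))" by auto
    moreover have "range (e(n := a)) \<subseteq> carrier H" using FEx.prems that by auto
    ultimately show ?thesis using FEx.IH by metis
  qed
  then show ?case by (simp add: copy_def)
qed simp_all

lemma copy_models:
  assumes "heyting_algebra H" and gf: "\<forall>x\<in>carrier H. g (f x) = x"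
  shows "models (copy f g H) \<phi> \<longleftrightarrow> models H \<phi>"
proof
  assume *: "models (copy f g H) \<phi>"
  show "models H \<phi>" unfolding models_def
  proof (intro allI impI)
    fix e :: "nat \<Rightarrow> 'a" assume e: "range e \<subseteq> carrier H"
    then have "range (\<lambda>n. f (e n)) \<subseteq> carrier (copy f g H)" by (auto simp: copy_def)
    then show "sat H e \<phi>"
      using * copy_sat[where f = f and g = g, OF assms e] unfolding models_def by blast
  qed
next
  assume "models H \<phi>"
  show "models (copy f g H) \<phi>" unfolding models_def
  proof (intro allI impI)
    fix e :: "nat \<Rightarrow> 'b" assume e: "range e \<subseteq> carrier (copy f g H)"
    have *: "g (e n) \<in> carrier H \<and> f (g (e n)) = e n" for n
    proof -
      have "e n \<in> f ` carrier H" using e by (auto simp: copy_def)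
      then show ?thesis using gf by auto
    qed
    then have ge: "range (\<lambda>n. g (e n)) \<subseteq> carrier H" by auto
    then have "sat H (\<lambda>n. g (e n)) \<phi>" using \<open>models H \<phi>\<close> by (simp add: models_def)
    then show "sat (copy f g H) e \<phi>"
      using copy_sat[where f = f and g = g, OF assms ge, of \<phi>] * by simp
  qed
qed

lemma copy_black_box:
  assumes "black_box H \<pi> I" and gf: "\<forall>x\<in>carrier H. g (f x) = x"
  shows "black_box (copy f g H) (\<lambda>x. f (\<pi> x)) I"
proof -
  interpret black_box H \<pi> I by fact
  interpret C: heyting_algebra "copy f g H"
    by (rule copy_heyting_algebra[where f = f and g = g, OF heyting_algebra_axioms gf])
  have inj: "inj_on f (carrier H)" using gf by (metis inj_onI)
  have "map_pmf (\<lambda>(x, t). f (\<pi> x)) (sample_alg I)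
      = map_pmf f (map_pmf (\<lambda>(x, t). \<pi> x) (sample_alg I))"
    by (simp add: pmf.map_comp o_def case_prod_unfold)
  also have "\<dots> = pmf_of_set (f ` carrier H)"
    using inj finite_carrier bottom_closed unfolding sample_uniform
    by (intro map_pmf_of_set_inj) auto
  finally have *: "map_pmf (\<lambda>(x, t). f (\<pi> x)) (sample_alg I) = pmf_of_set (f ` carrier H)" .
  show ?thesis
    using * finite_carrier crypto_length decrypt_mem sample_crypto meet_crypto join_crypto
      imp_crypto bottom_crypto top_crypto
      decrypt_meet decrypt_join decrypt_imp decrypt_bottom decrypt_top
      eq_correct inj
    by unfold_locales (auto simp: copy_def gf inj_on_eq_iff)
qed

lemma one_sided_monte_carlo_nat:
  assumes "one_sided_monte_carlo TYPE(nat) \<phi> A"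
  shows "one_sided_monte_carlo TYPE('a) \<phi> A"
  unfolding one_sided_monte_carlo_def
proof
  fix p :: "nat poly"
  obtain q :: "nat poly" where q: "\<And>(H :: nat heyting) \<pi> I.
      black_box H \<pi> I \<and> interface_time_le I (poly p (len I)) \<Longrightarrow>
      (let D = output_within I A (poly q (len I)) in
         (models H \<phi> \<longrightarrow> D = return_pmf (Some [True])) \<and>
         (\<not> models H \<phi> \<longrightarrow>
            pmf D (Some [False]) > 1/2 \<and> set_pmf D \<subseteq> {Some [False], Some [True]}))"
    using assms unfolding one_sided_monte_carlo_def by blast
  show "\<exists>q :: nat poly. \<forall>(H :: 'a heyting) \<pi> I.
      black_box H \<pi> I \<and> interface_time_le I (poly p (len I)) \<longrightarrow>
      (let D = output_within I A (poly q (len I)) in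
         (models H \<phi> \<longrightarrow> D = return_pmf (Some [True])) \<and>
         (\<not> models H \<phi> \<longrightarrow>
            pmf D (Some [False]) > 1/2 \<and> set_pmf D \<subseteq> {Some [False], Some [True]}))"
  proof (intro exI[of _ q] allI impI, elim conjE)
    fix H :: "'a heyting" and \<pi> I
    assume bb: "black_box H \<pi> I" and t: "interface_time_le I (poly p (len I))"
    interpret black_box H \<pi> I by fact
    obtain f :: "'a \<Rightarrow> nat" where "inj_on f (carrier H)"
      using finite_imp_inj_to_nat_seg[OF finite_carrier] by blast
    then have gf: "\<forall>x\<in>carrier H. inv_into (carrier H) f (f x) = x" by simp
    show "let D = output_within I A (poly q (len I)) in
         (models H \<phi> \<longrightarrow> D = return_pmf (Some [True])) \<and>
         (\<not> models H \<phi> \<longrightarrow>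
            pmf D (Some [False]) > 1/2 \<and> set_pmf D \<subseteq> {Some [False], Some [True]})"
      using q[OF conjI[OF copy_black_box[where f = f and g = "inv_into (carrier H) f", OF bb gf] t]]
        copy_models[where f = f and g = "inv_into (carrier H) f", OF heyting_algebra_axioms gf, of \<phi>] by simp
  qed
qed

end

theory Submission
  imports Defs
begin

text \<open>
  A Heyting algebra is Boolean iff \<open>x \<or> \<not>x = \<top>\<close> for all \<open>x\<close>, i.e. iff every element is
  complemented. If it is finite and not Boolean, at most two thirds of its elements are
  complemented: for a non-complemented \<open>a\<close> the element \<open>d = a \<or> \<not>a\<close> is dense and \<open>d \<noteq> \<top>\<close>. On the
  set \<open>C\<close> of complemented elements \<open>c \<mapsto> c \<and> d\<close> is injective, and \<open>c \<and> d\<close> is complemented only if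
  \<open>c \<le> d\<close>, which cannot hold for both \<open>c\<close> and \<open>\<not>c\<close>. So at least half of \<open>C\<close> is mapped
  injectively into the complement of \<open>C\<close>. Hence testing two independent random elements detects
  a non-Boolean algebra with probability at least \<open>1 - (2/3)\<^sup>2 = 5/9\<close>.
\<close>

section \<open>Complemented elements of a Heyting algebra\<close>

text \<open>Excluded middle for \<open>a\<close>; as \<open>meet H a (neg H a)\<close> is always
  bottom (\<open>meet_neg\<close>), \<open>neg H a\<close> is then a lattice complement.\<close>

definition complemented :: "'a heyting \<Rightarrow> 'a \<Rightarrow> bool" where
  "complemented H a \<longleftrightarrow> join H a (neg H a) = topel H"

context heyting_algebra
begin

section \<open>The lattice order\<close>

lemmas closed [simp] = bottom_closed top_closed meet_closed join_closed imp_closed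

lemma neg_closed [simp]: "a \<in> carrier H \<Longrightarrow> neg H a \<in> carrier H"
  by (simp add: neg_def)

lemma le_refl: "a \<in> carrier H \<Longrightarrow> le H a a"
  by (metis join_absorb meet_absorb meet_closed le_def)

lemma le_trans:
  "\<lbrakk>le H a b; le H b c; a \<in> carrier H; b \<in> carrier H; c \<in> carrier H\<rbrakk> \<Longrightarrow> le H a c"
  by (metis le_def meet_assoc)

lemma le_antisym: "\<lbrakk>le H a b; le H b a; a \<in> carrier H; b \<in> carrier H\<rbrakk> \<Longrightarrow> a = b"
  by (metis le_def meet_comm)

lemma meet_le1: "\<lbrakk>a \<in> carrier H; b \<in> carrier H\<rbrakk> \<Longrightarrow> le H (meet H a b) a"
  by (metis le_def le_refl meet_assoc meet_comm meet_closed)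

lemma meet_le2: "\<lbrakk>a \<in> carrier H; b \<in> carrier H\<rbrakk> \<Longrightarrow> le H (meet H a b) b"
  by (metis meet_comm meet_le1)

lemma le_meetI:
  "\<lbrakk>le H c a; le H c b; a \<in> carrier H; b \<in> carrier H; c \<in> carrier H\<rbrakk> \<Longrightarrow> le H c (meet H a b)"
  by (metis le_def meet_assoc)

lemma le_join1: "\<lbrakk>a \<in> carrier H; b \<in> carrier H\<rbrakk> \<Longrightarrow> le H a (join H a b)"
  by (simp add: le_def meet_absorb)

lemma le_join2: "\<lbrakk>a \<in> carrier H; b \<in> carrier H\<rbrakk> \<Longrightarrow> le H b (join H a b)"
  by (metis join_comm le_join1)

lemma join_leI:
  assumes "le H a c" "le H b c" "a \<in> carrier H" "b \<in> carrier H" "c \<in> carrier H"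
  shows "le H (join H a b) c"
  using assms distrib[of c a b] by (metis join_closed le_def meet_comm)

lemma le_bottomD: "\<lbrakk>le H a (bottom H); a \<in> carrier H\<rbrakk> \<Longrightarrow> a = bottom H"
  using bottom_least le_antisym by simp

lemma top_leD: "\<lbrakk>le H (topel H) a; a \<in> carrier H\<rbrakk> \<Longrightarrow> a = topel H"
  using top_greatest le_antisym by simp

section \<open>Negation, complemented and dense elements\<close>

lemma meet_neg: "a \<in> carrier H \<Longrightarrow> meet H a (neg H a) = bottom H"
  unfolding neg_def using imp_mem le_bottomD by simp

lemma le_negI:
  "\<lbrakk>meet H a c = bottom H; a \<in> carrier H; c \<in> carrier H\<rbrakk> \<Longrightarrow> le H c (neg H a)"
  unfolding neg_def by (simp add: imp_greatest le_refl)

lemma le_neg_neg: "a \<in> carrier H \<Longrightarrow> le H a (neg H (neg H a))"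
  by (metis le_negI meet_comm meet_neg neg_closed)

text \<open>Distributing \<open>x\<close> over \<open>join H e (neg H e)\<close>, which is the top,
  leaves only \<open>meet H x e\<close>.\<close>

lemma le_complementedI:
  assumes "complemented H e" "meet H x (neg H e) = bottom H" "x \<in> carrier H" "e \<in> carrier H"
  shows "le H x e"
proof -
  have "x = meet H x (join H e (neg H e))"
    using assms top_greatest by (metis complemented_def le_def)
  also have "\<dots> = join H (meet H x e) (bottom H)"
    using assms distrib by simp
  finally have "x = join H (meet H x e) (bottom H)" .
  moreover have "le H (join H (meet H x e) (bottom H)) e"
    using assms by (intro join_leI meet_le2 bottom_least) auto
  ultimately show ?thesis by simp
qed

lemma complemented_neg:
  assumes "complemented H c" "c \<in> carrier H"
  shows "complemented H (neg H c)"
proof -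
  have "le H (join H c (neg H c)) (join H (neg H c) (neg H (neg H c)))"
    using assms(2) by (intro join_leI le_join1) (auto intro: le_trans[OF le_neg_neg le_join2])
  then show ?thesis
    using assms unfolding complemented_def by (simp add: top_leD)
qed

text \<open>The double negation is disjoint from \<open>neg H c\<close>, so
  \<open>le_complementedI\<close> puts it below \<open>c\<close>. Negation is thus an involution on
  complemented elements.\<close>

lemma complemented_neg_neg:
  assumes "complemented H c" "c \<in> carrier H"
  shows "neg H (neg H c) = c"
proof (rule le_antisym)
  show "le H (neg H (neg H c)) c"
    using assms meet_neg[of "neg H c"] by (intro le_complementedI) (simp_all add: meet_comm)
qed (use assms le_neg_neg in simp_all)

text \<open>With \<open>d\<close> for the join, \<open>neg H d\<close> is disjoint from
  \<open>a\<close>, hence below \<open>neg H a\<close> and so below \<open>d\<close>; being also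
  disjoint from \<open>d\<close>, it is bottom.\<close>

lemma neg_join_neg:
  assumes "a \<in> carrier H"
  shows "neg H (join H a (neg H a)) = bottom H"
proof -
  define d where "d = join H a (neg H a)"
  have d: "d \<in> carrier H" using assms by (simp add: d_def)
  have "le H (meet H a (neg H d)) (meet H d (neg H d))"
    using assms d unfolding d_def
    by (intro le_meetI meet_le2 le_trans[OF meet_le1 le_join1]) auto
  then have "meet H a (neg H d) = bottom H"
    using assms d by (intro le_bottomD) (auto simp: meet_neg)
  then have "le H (neg H d) (neg H a)"
    using assms d by (intro le_negI) auto
  then have "le H (neg H d) d"
    using le_trans[OF _ le_join2] assms d unfolding d_def by simp
  then show ?thesis
    using d meet_neg meet_comm unfolding d_def[symmetric] by (metis le_def neg_closed)
qed

text \<open>The part of \<open>c\<close> inside \<open>neg H e\<close> meets \<open>d\<close> below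
  both \<open>e\<close> and \<open>neg H e\<close>, hence in bottom; so it lies below
  \<open>neg H d\<close>, which is bottom.\<close>

lemma le_complemented_if_meet_dense_le:
  assumes dense: "neg H d = bottom H" and e: "complemented H e" and le: "le H (meet H c d) e"
    and mem: "c \<in> carrier H" "d \<in> carrier H" "e \<in> carrier H"
  shows "le H c e"
proof (rule le_complementedI[OF e])
  let ?m = "meet H c (neg H e)"
  have "le H (meet H d ?m) (meet H e (neg H e))"
  proof (rule le_meetI)
    have "le H (meet H d ?m) (meet H c d)"
      using mem by (intro le_meetI meet_le1 le_trans[OF meet_le2 meet_le1]) auto
    then show "le H (meet H d ?m) e"
      using le le_trans mem by (meson meet_closed neg_closed)
    show "le H (meet H d ?m) (neg H e)"
      using mem by (intro le_trans[OF meet_le2 meet_le2]) auto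
  qed (use mem in auto)
  then have "meet H d ?m = bottom H"
    using mem by (intro le_bottomD) (auto simp: meet_neg)
  then have "le H ?m (bottom H)"
    using mem le_negI[of d ?m] dense by simp
  then show "?m = bottom H"
    using mem by (intro le_bottomD) auto
qed (use mem in auto)

text \<open>Forward: take \<open>y = x\<close>, where the implication is the top. Backward: split
  \<open>imp H x y\<close> along \<open>join H x (neg H x)\<close>; one part lies below
  \<open>y\<close>, the other below \<open>neg H x\<close>.\<close>

lemma boolean_algebra_iff_complemented:
  "boolean_algebra H \<longleftrightarrow> (\<forall>x\<in>carrier H. complemented H x)"
proof
  assume b: "boolean_algebra H"
  show "\<forall>x\<in>carrier H. complemented H x"
  proof
    fix x assume x: "x \<in> carrier H"
    have "le H (topel H) (imp H x x)"
      using x by (intro imp_greatest meet_le1) auto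
    then have "imp H x x = topel H"
      using x by (simp add: top_leD)
    then show "complemented H x"
      using b x unfolding boolean_algebra_def complemented_def
      by (metis join_comm neg_closed)
  qed
next
  assume c: "\<forall>x\<in>carrier H. complemented H x"
  have "imp H x y = join H (neg H x) y" if x: "x \<in> carrier H" and y: "y \<in> carrier H" for x y
  proof (rule le_antisym)
    let ?i = "imp H x y"
    have "?i = meet H ?i (join H x (neg H x))"
      using c x y top_greatest by (metis complemented_def imp_closed le_def)
    also have "\<dots> = join H (meet H ?i x) (meet H ?i (neg H x))"
      using x y by (simp add: distrib)
    finally have i: "?i = join H (meet H ?i x) (meet H ?i (neg H x))" .
    have "le H (meet H ?i x) y"
      using imp_mem x y by (simp add: meet_comm)
    then have "le H (meet H ?i x) (join H (neg H x) y)"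
      using le_trans[OF _ le_join2] x y by simp
    moreover have "le H (meet H ?i (neg H x)) (join H (neg H x) y)"
      using le_trans[OF meet_le2 le_join1] x y by simp
    ultimately have "le H (join H (meet H ?i x) (meet H ?i (neg H x))) (join H (neg H x) y)"
      using x y by (intro join_leI) auto
    then show "le H ?i (join H (neg H x) y)"
      using i by simp
    have "le H (meet H x (neg H x)) y"
      using x y by (simp add: meet_neg bottom_least)
    then show "le H (join H (neg H x) y) ?i"
      using x y by (intro join_leI imp_greatest meet_le2) auto
  qed (use x y in auto)
  then show "boolean_algebra H"
    unfolding boolean_algebra_def using heyting_algebra_axioms by blast
qed

section \<open>Counting complemented elements\<close>

lemma card_complemented_le:
  assumes fin: "finite (carrier H)" and "\<not> boolean_algebra H"
  shows "3 * card {x \<in> carrier H. complemented H x} \<le> 2 * card (carrier H)"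
proof -
  obtain a where a: "a \<in> carrier H" "\<not> complemented H a"
    using assms boolean_algebra_iff_complemented by blast
  define d where "d = join H a (neg H a)"
  have d: "d \<in> carrier H" "neg H d = bottom H" "d \<noteq> topel H"
    using a neg_join_neg unfolding d_def complemented_def by auto
  define C where "C = {x \<in> carrier H. complemented H x}"
  define N where "N = {c \<in> C. \<not> le H c d}"
  have finC: "finite C" using fin by (simp add: C_def)
  have C_sub: "C \<subseteq> carrier H" and N_sub: "N \<subseteq> C"
    by (auto simp: C_def N_def)
  \<comment> \<open>If \<open>c\<close> and \<open>neg H c\<close> were both below \<open>d\<close>,
    so would be their join, the top. So one of them is in \<open>N\<close>, and negating twice leads
    back to \<open>c\<close>.\<close>
  have CN: "C \<subseteq> N \<union> neg H ` N"
  proof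
    fix c assume c: "c \<in> C"
    then have nc: "neg H c \<in> C" "neg H (neg H c) = c"
      by (auto simp: C_def complemented_neg complemented_neg_neg)
    have "\<not> (le H c d \<and> le H (neg H c) d)"
    proof
      assume "le H c d \<and> le H (neg H c) d"
      then have "le H (join H c (neg H c)) d"
        using c d by (intro join_leI) (auto simp: C_def)
      then show False
        using c d top_leD by (auto simp: C_def complemented_def)
    qed
    then have "c \<in> N \<or> neg H c \<in> N"
      using c nc by (auto simp: N_def)
    then show "c \<in> N \<union> neg H ` N"
      using nc by (metis UnCI imageI)
  qed
  have finN: "finite N" using finC N_sub by (rule rev_finite_subset)
  have "card C \<le> card (N \<union> neg H ` N)"
    using CN finN by (intro card_mono) auto
  also have "\<dots> \<le> card N + card (neg H ` N)"
    by (rule card_Un_le)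
  also have "\<dots> \<le> 2 * card N"
    using card_image_le[OF finN, of "neg H"] by simp
  finally have half: "card C \<le> 2 * card N" .
  have "inj_on (\<lambda>c. meet H c d) N"
  proof (rule inj_onI)
    \<comment> \<open>Equal meets with \<open>d\<close> put \<open>meet H c d\<close> below
      \<open>e\<close>, hence \<open>c\<close> below \<open>e\<close>; equality follows by
      symmetry.\<close>
    have "le H c e" if "c \<in> N" "e \<in> N" "meet H c d = meet H e d" for c e
      using that d meet_le1[of e d]
      by (intro le_complemented_if_meet_dense_le[of d e c]) (auto simp: N_def C_def)
    then show "c = e" if "c \<in> N" "e \<in> N" "meet H c d = meet H e d" for c e
      using that by (intro le_antisym) (auto simp: N_def C_def)
  qed
  moreover have "(\<lambda>c. meet H c d) ` N \<subseteq> carrier H - C"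
  proof (rule image_subsetI)
    fix c assume c: "c \<in> N"
    have "\<not> complemented H (meet H c d)"
    \<comment> \<open>Otherwise density, with \<open>meet H c d\<close> itself as the complemented
      bound, would give \<open>c\<close> below \<open>d\<close>.\<close>
    proof
      assume "complemented H (meet H c d)"
      then have "le H c (meet H c d)"
        using c d by (intro le_complemented_if_meet_dense_le[of d _ c])
          (auto simp: N_def C_def le_refl)
      then have "le H c d"
        using c d meet_le2[of c d] le_trans[of c "meet H c d" d] by (auto simp: N_def C_def)
      then show False using c by (simp add: N_def)
    qed
    then show "meet H c d \<in> carrier H - C"
      using c d by (auto simp: N_def C_def)
  qed
  ultimately have "card N \<le> card (carrier H - C)"
    using fin by (intro card_inj_on_le) auto
  also have "\<dots> = card (carrier H) - card C"
    using C_sub finC by (rule card_Diff_subset[rotated])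
  finally have "card N \<le> card (carrier H) - card C" .
  \<comment> \<open>Makes the truncated subtraction exact, so that
    \<open>card C \<le> 2 * card N\<close> gives the claim.\<close>
  moreover have "card C \<le> card (carrier H)"
    using C_sub fin by (rule card_mono[rotated])
  ultimately show ?thesis
    using half unfolding C_def by linarith
qed

end


section \<open>The algorithm\<close>

text \<open>
  For samples \<open>x\<close> and \<open>y\<close>, the program compares \<open>(x \<or> \<not>x) \<and> (y \<or> \<not>y)\<close> with \<open>\<top>\<close>; taking the meet
  combines the two tests without branching.
\<close>

definition boolean_test :: com where
  "boolean_test =
     Seq (Query 1 QSample) (
     Seq (Query 2 QSample) (
     Seq (Query 3 QBottom) (
     Seq (Query 4 (QImp 1 3)) (
     Seq (Query 5 (QImp 2 3)) (
     Seq (Query 4 (QJoin 1 4)) (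
     Seq (Query 5 (QJoin 2 5)) (
     Seq (Query 4 (QMeet 4 5)) (
     Seq (Query 5 QTop) (
     Query 0 (QEq 4 5))))))))))"

section \<open>Symbolic execution of the program\<close>

lemma run_halted: "run I n ([], s, t) = return_pmf ([], s, t)"
  by (induction n) (simp_all add: bind_return_pmf)

text \<open>One step unfolds the \<open>Seq\<close>, the next executes the query: hence two
  \<open>Suc\<close> and the \<open>2\<close> in the elapsed time.\<close>

lemma run_Seq_Query:
  "run I (Suc (Suc n)) (Seq (Query r q) c # K, s, t) =
     bind_pmf (answer I s q) (\<lambda>(a, u). run I n (c # K, s(r := a), t + 2 + u))"
  by (simp add: bind_return_pmf map_pmf_def bind_assoc_pmf case_prod_unfold)

lemma run_Query:
  "run I (Suc n) (Query r q # K, s, t) =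
     bind_pmf (answer I s q) (\<lambda>(a, u). run I n (K, s(r := a), t + 1 + u))"
  by (simp add: bind_return_pmf map_pmf_def bind_assoc_pmf case_prod_unfold)

context black_box
begin

text \<open>The constant is 19 = 9 * 2 + 1: nine \<open>Seq\<close> commands, each with its query,
  and a final query. The ten queries add at most \<open>T\<close> each.\<close>

lemma output_boolean_test:
  assumes time: "interface_time_le I T" and "T' \<ge> 19 + 10 * T"
  shows "output_within I boolean_test T' =
    map_pmf (\<lambda>(a, b). Some [complemented H a \<and> complemented H b])
      (pair_pmf (pmf_of_set (carrier H)) (pmf_of_set (carrier H)))"
proof -
  define neg_c where "neg_c x = imp_alg I x (fst (bottom_alg I))" for x
  define lem_c where "lem_c x = join_alg I x (fst (neg_c x))" for x
  define meet_c where "meet_c x y = meet_alg I (fst (lem_c x)) (fst (lem_c y))" for x y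
  define eq_c where "eq_c x y = eq_alg I (fst (meet_c x y)) (fst (top_alg I))" for x y
  define time where "time x t y u = 19 + t + u + snd (bottom_alg I) + snd (neg_c x) + snd (neg_c y)
    + snd (lem_c x) + snd (lem_c y) + snd (meet_c x y) + snd (top_alg I) + snd (eq_c x y)"
    for x y and t u :: nat
  let ?dec = "\<lambda>(x :: bits, t :: nat). \<pi> x"
  obtain m where m: "T' = 19 + m"
    using assms(2) by (metis add.assoc le_iff_add)
  \<comment> \<open>Exposing 19 \<open>Suc\<close> lets the unfolding lemmas apply; the remaining
    \<open>m\<close> steps are spent in the halted configuration.\<close>
  have steps: "run I T' cf = run I (Suc (Suc (Suc (Suc (Suc (Suc (Suc (Suc (Suc (Suc (Suc (Suc
      (Suc (Suc (Suc (Suc (Suc (Suc (Suc m))))))))))))))))))) cf" for cf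
    unfolding m by (rule arg_cong[where f = "\<lambda>n. run I n cf"]) simp
  have "output_within I boolean_test T' =
    bind_pmf (sample_alg I) (\<lambda>(x, t). bind_pmf (sample_alg I) (\<lambda>(y, u).
      return_pmf (if time x t y u \<le> T' then Some [fst (eq_c x y)] else None)))"
    unfolding output_within_def
    unfolding steps init_def boolean_test_def run_Seq_Query run_Query run_halted
    by (simp add: map_bind_pmf bind_return_pmf case_prod_unfold neg_c_def
          lem_c_def meet_c_def eq_c_def time_def cong: if_cong)
      (intro bind_pmf_cong refl arg_cong[where f = return_pmf] if_cong, arith)
  also have "\<dots> = bind_pmf (sample_alg I) (\<lambda>(x, t). bind_pmf (sample_alg I) (\<lambda>(y, u).
      return_pmf (Some [complemented H (\<pi> x) \<and> complemented H (\<pi> y)])))"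
  \<comment> \<open>On the support of the sampler the time limit is met and the correctness of the
    interface applies, so only the decrypted samples matter.\<close>
  proof (intro bind_pmf_cong refl, clarify, intro bind_pmf_cong refl, clarify)
    fix x t y u
    assume xt: "(x, t) \<in> set_pmf (sample_alg I)" and yu: "(y, u) \<in> set_pmf (sample_alg I)"
    have lem: "fst (neg_c z) \<in> crypto I \<and> fst (lem_c z) \<in> crypto I
        \<and> \<pi> (fst (lem_c z)) = join H (\<pi> z) (neg H (\<pi> z))" if "z \<in> crypto I" for z
      using that by (simp add: neg_c_def lem_c_def neg_def imp_crypto join_crypto bottom_crypto
          decrypt_imp decrypt_join decrypt_bottom)
    have mem: "x \<in> crypto I" "y \<in> crypto I"
      using xt yu sample_crypto by auto
    have meet: "fst (meet_c x y) \<in> crypto I"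
      using mem lem by (simp add: meet_c_def meet_crypto)
    have pi: "\<pi> x \<in> carrier H" "\<pi> y \<in> carrier H"
      using mem decrypt_mem by auto
    have "t \<le> T" "u \<le> T" "snd (bottom_alg I) \<le> T" "snd (neg_c x) \<le> T" "snd (neg_c y) \<le> T"
      "snd (lem_c x) \<le> T" "snd (lem_c y) \<le> T" "snd (meet_c x y) \<le> T" "snd (top_alg I) \<le> T"
      "snd (eq_c x y) \<le> T"
      using \<open>interface_time_le I T\<close> xt yu mem lem meet bottom_crypto top_crypto
      unfolding interface_time_le_def neg_c_def lem_c_def meet_c_def eq_c_def by auto
    then have "time x t y u \<le> T'"
      using assms(2) unfolding time_def by linarith
    moreover have "fst (eq_c x y) \<longleftrightarrow> complemented H (\<pi> x) \<and> complemented H (\<pi> y)"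
    proof -
      let ?a = "join H (\<pi> x) (neg H (\<pi> x))" and ?b = "join H (\<pi> y) (neg H (\<pi> y))"
      have "fst (eq_c x y) \<longleftrightarrow> meet H ?a ?b = topel H"
        using meet mem lem by (simp add: eq_c_def eq_correct top_crypto decrypt_top meet_c_def
            decrypt_meet)
      also have "\<dots> \<longleftrightarrow> ?a = topel H \<and> ?b = topel H"
        using pi meet_le1[of ?a ?b] meet_le2[of ?a ?b] le_refl[of "topel H"]
        by (auto simp: top_leD le_def)
      finally show ?thesis by (simp add: complemented_def)
    qed
    ultimately show "return_pmf (if time x t y u \<le> T' then Some [fst (eq_c x y)] else None) =
        return_pmf (Some [complemented H (\<pi> x) \<and> complemented H (\<pi> y)])"
      by simp
  qed
  \<comment> \<open>Decryption moves into each sample, which \<open>sample_uniform\<close> then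
    makes uniform.\<close>
  also have "\<dots> = map_pmf (\<lambda>(a, b). Some [complemented H a \<and> complemented H b])
      (pair_pmf (map_pmf ?dec (sample_alg I)) (map_pmf ?dec (sample_alg I)))"
    by (simp add: pair_pmf_def map_pmf_def bind_assoc_pmf bind_return_pmf case_prod_unfold)
  finally show ?thesis
    by (simp add: sample_uniform)
qed

text \<open>Acceptance means that the pair lies in \<open>C \<times> C\<close>, which has
  probability at most 4/9 by \<open>card_complemented_le\<close>.\<close>

lemma prob_reject_boolean_test:
  assumes "\<not> boolean_algebra H"
  shows "pmf (map_pmf (\<lambda>(a, b). Some [complemented H a \<and> complemented H b])
      (pair_pmf (pmf_of_set (carrier H)) (pmf_of_set (carrier H)))) (Some [False]) \<ge> 5/9"
proof -
  define C where "C = {x \<in> carrier H. complemented H x}"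
  let ?U = "pmf_of_set (carrier H)"
  let ?f = "\<lambda>(a, b). Some [complemented H a \<and> complemented H b]"
  have ne: "carrier H \<noteq> {}" using bottom_closed by blast
  have sub: "C \<subseteq> carrier H" by (auto simp: C_def)
  have n: "card (carrier H) > 0" using ne finite_carrier by (simp add: card_gt_0_iff)
  \<comment> \<open>Two independent uniform choices are one uniform choice of a pair, so the
    probability becomes a quotient of cardinalities.\<close>
  have pair: "pair_pmf ?U ?U = pmf_of_set (carrier H \<times> carrier H)"
  proof (intro pmf_eqI, clarify)
    show "pmf (pair_pmf ?U ?U) (a, b) = pmf (pmf_of_set (carrier H \<times> carrier H)) (a, b)" for a b
      using ne finite_carrier by (simp add: pmf_pair indicator_def card_cartesian_product)
  qed
  have "pmf (map_pmf ?f (pair_pmf ?U ?U)) (Some [False]) =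
      card ((carrier H \<times> carrier H) \<inter> ?f -` {Some [False]}) / card (carrier H \<times> carrier H)"
    using ne finite_carrier unfolding pair by (simp add: pmf_map measure_pmf_of_set)
  also have "(carrier H \<times> carrier H) \<inter> ?f -` {Some [False]} = carrier H \<times> carrier H - C \<times> C"
    by (auto simp: C_def)
  also have "card (carrier H \<times> carrier H - C \<times> C) = card (carrier H)^2 - card C^2"
    using finite_carrier finite_subset[OF sub] sub
    by (subst card_Diff_subset) (auto simp: card_cartesian_product power2_eq_square)
  also have "real (card (carrier H)^2 - card C^2) = real (card (carrier H))^2 - real (card C)^2"
    using card_mono[OF finite_carrier sub] by (simp add: of_nat_diff power_mono)
  finally have eq: "pmf (map_pmf ?f (pair_pmf ?U ?U)) (Some [False]) =
      (real (card (carrier H))^2 - real (card C)^2) / real (card (carrier H))^2"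
    by (simp add: card_cartesian_product power2_eq_square)
  have "3 * card C \<le> 2 * card (carrier H)"
    using card_complemented_le[OF finite_carrier assms] by (simp add: C_def)
  then have "(3 * card C)^2 \<le> (2 * card (carrier H))^2"
    by (rule power_mono) simp
  then have "9 * (card C)^2 \<le> 4 * (card (carrier H))^2"
    by (simp add: power_mult_distrib)
  then have "9 * real (card C)^2 \<le> 4 * real (card (carrier H))^2"
    by (metis (mono_tags, lifting) of_nat_le_iff of_nat_mult of_nat_numeral of_nat_power)
  then show ?thesis
    using n unfolding eq by (simp add: field_simps)
qed

end

theorem theorem5p6:
  shows "\<exists>A. one_sided_monte_carlo TYPE('a) boolean_sentence A"
proof (intro exI[of _ boolean_test], unfold one_sided_monte_carlo_def, rule allI)
  fix p :: "nat poly"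
  \<comment> \<open>Matches the limit \<open>19 + 10 * T\<close> of
    \<open>output_boolean_test\<close> for \<open>T = poly p (len I)\<close>.\<close>
  define q :: "nat poly" where "q = [:19:] + smult 10 p"
  show "\<exists>q :: nat poly. \<forall>(H :: 'a heyting) \<pi> I.
        black_box H \<pi> I \<and> interface_time_le I (poly p (len I)) \<longrightarrow>
        (let D = output_within I boolean_test (poly q (len I)) in
           (models H boolean_sentence \<longrightarrow> D = return_pmf (Some [True])) \<and>
           (\<not> models H boolean_sentence \<longrightarrow>
              pmf D (Some [False]) > 1/2 \<and> set_pmf D \<subseteq> {Some [False], Some [True]}))"
  proof (intro exI[of _ q] allI impI, elim conjE)
    fix H :: "'a heyting" and \<pi> I
    assume "black_box H \<pi> I" and time: "interface_time_le I (poly p (len I))"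
    then interpret black_box H \<pi> I by simp
    let ?U = "pmf_of_set (carrier H)"
    define D where "D = output_within I boolean_test (poly q (len I))"
    have D: "D = map_pmf (\<lambda>(a, b). Some [complemented H a \<and> complemented H b]) (pair_pmf ?U ?U)"
      unfolding D_def by (rule output_boolean_test[OF time]) (simp add: q_def)
    have "carrier H \<noteq> {}" using bottom_closed by blast
    then have set_U: "set_pmf ?U = carrier H" using finite_carrier by simp
    have models: "models H boolean_sentence \<longleftrightarrow> boolean_algebra H"
      by (rule models_boolean_sentence) (rule heyting_algebra_axioms)
    have "D = return_pmf (Some [True])" if "boolean_algebra H"
    proof -
      have "D = map_pmf (\<lambda>_. Some [True]) (pair_pmf ?U ?U)"
        unfolding D using that boolean_algebra_iff_complemented set_U
        by (intro map_pmf_cong refl) auto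
      then show ?thesis by simp
    qed
    \<comment> \<open>5/9 exceeds 1/2; for a single sample the same counting would only give
      1/3.\<close>
    moreover have "pmf D (Some [False]) > 1/2" if "\<not> boolean_algebra H"
      using prob_reject_boolean_test[OF that] unfolding D by linarith
    moreover have "set_pmf D \<subseteq> {Some [False], Some [True]}"
      unfolding D by auto
    ultimately show "let D = output_within I boolean_test (poly q (len I)) in
           (models H boolean_sentence \<longrightarrow> D = return_pmf (Some [True])) \<and>
           (\<not> models H boolean_sentence \<longrightarrow>
              pmf D (Some [False]) > 1/2 \<and> set_pmf D \<subseteq> {Some [False], Some [True]})"
      unfolding models D_def Let_def by blast
  qed
qed

end
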